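(* Let $k\ge 1$ be an integer and, for $n\ge 1$, let $\mathcal{L}_{n}^{(k)}$ be the bounded poset described in the context, with least element $\hat 0$ and greatest element $\hat 1$, and write $\mu(\mathcal{L}_n^{(k)}):=\mu(\hat 0,\hat 1)$ for its M\"obius function. Then, as formal power series in $x$, $$\Gamma^{(k)}(x):=\sum_{n\ge 0}(-1)^{n+1}\mu(\mathcal{L}_{n+1}^{(k)})\frac{x^{n}}{n!}=(1-kx)^{-(k-1)/k}.$$
   Context: Fix integers $n\ge1$, $k\ge1$ and write $[n]=\{1,\dots,n\}$. A weighted partition of $[n]$ with $k$ layers is a $k$-tuple $\pi=(\pi^{(1)},\dots,\pi^{(k)})$ of set partitions of $[n]$ such that $\pi^{(l+1)}$ refines $\pi^{(l)}$ for $1\le l<k$ (the paper records, for $l\ge2$, only the blocks of $\pi^{(l)}$ of size $\ge2$; this is equivalent). Let $\mathcal{P}_n^{(k)}$ be the set of weighted partitions of $[n]$ with $k$ layers, and define the rank $\rho(\pi)=n-(\text{number of blocks of }\pi^{(1)})$. Labeled covers: for $\pi\in\mathcal{P}_n^{(k)}$, integers $1\le\alpha<\beta\le n$ and $l\in[k]$, the label $(\alpha,\beta)_l$ is admissible at $\pi$ if $\alpha$ and $\beta$ lie in different blocks $A\ni\alpha$, $B\ni\beta$ of $\pi^{(1)}$, $\beta=\min B$, and $\alpha$ is the smallest element of its block in $\pi^{(l)}$. In that case let $\pi'$ be obtained by replacing, for each $m=1,\dots,l$, the two blocks of $\pi^{(m)}$ containing $\alpha$ and $\beta$ by their union, and keeping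 $\pi'^{(m)}=\pi^{(m)}$ for $m>l$; we declare $\pi\lessdot\pi'$ with edge label $(\alpha,\beta)_l$. The order $\le$ on $\mathcal{P}_n^{(k)}$ is the reflexive-transitive closure of these covers. The poset $\mathcal{L}_n^{(k)}$ is $\mathcal{P}_n^{(k)}\cup\{\hat 1\}$ where additionally $\pi\lessdot\hat 1$ (edge label $(1,n)_k$) for every $\pi$ with $\rho(\pi)=n-1$, and $\rho(\hat1)=n$; its least element $\hat 0$ is the weighted partition all of whose layers are the partition of $[n]$ into singletons. The M\"obius function is $\mu(x,x)=1$ and $\mu(x,y)=-\sum_{x\le z<y}\mu(x,z)$ for $x<y$. *)

theory Defs
  imports
    "HOL-Library.Disjoint_Sets"
    "HOL-Library.FuncSet"
    "HOL-Computational_Algebra.Formal_Power_Series"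
begin

subsection \<open>The Moebius function of a poset\<close>

text \<open>
  The poset is given by its carrier \<open>A\<close> and its order \<open>le\<close>. The recursion runs along the strict
  order, which must be well-founded for the definition to be meaningful (see \<open>moebius_rec\<close>).
  For \<open>x\<close> not below \<open>y\<close> the sum is empty, so the value is \<open>0\<close>.
\<close>

definition strict_rel :: "'a set \<Rightarrow> ('a \<Rightarrow> 'a \<Rightarrow> bool) \<Rightarrow> ('a \<times> 'a) set" where
  "strict_rel A le = {(z, y). z \<in> A \<and> y \<in> A \<and> le z y \<and> z \<noteq> y}"

definition moebius :: "'a set \<Rightarrow> ('a \<Rightarrow> 'a \<Rightarrow> bool) \<Rightarrow> 'a \<Rightarrow> 'a \<Rightarrow> int" where
  "moebius A le x =
     wfrec (strict_rel A le)
       (\<lambda>f y. if y = x then 1 else - (\<Sum>z | z \<in> A \<and> le x z \<and> le z y \<and> z \<noteq> y. f z))"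

lemma moebius_rec:
  assumes "wf (strict_rel A le)" and "y \<in> A"
  shows "moebius A le x y =
    (if y = x then 1 else - (\<Sum>z | z \<in> A \<and> le x z \<and> le z y \<and> z \<noteq> y. moebius A le x z))"
proof -
  have "(\<Sum>z | z \<in> A \<and> le x z \<and> le z y \<and> z \<noteq> y. cut (moebius A le x) (strict_rel A le) y z) =
        (\<Sum>z | z \<in> A \<and> le x z \<and> le z y \<and> z \<noteq> y. moebius A le x z)"
    using assms(2) by (intro sum.cong) (auto simp: cut_def strict_rel_def)
  then show ?thesis
    by (subst moebius_def, subst wfrec[OF assms(1)]) (simp flip: moebius_def)
qed


subsection \<open>Weighted partitions\<close>

text \<open>A weighted partition \<open>p\<close> with \<open>k\<close> layers is a function on \<open>{1..k}\<close>; \<open>p l\<close> is its \<open>l\<close>-th layer.\<close>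

type_synonym wpartition = "nat \<Rightarrow> nat set set"

definition refines :: "'a set set \<Rightarrow> 'a set set \<Rightarrow> bool" where
  "refines P Q \<longleftrightarrow> (\<forall>B\<in>P. \<exists>C\<in>Q. B \<subseteq> C)"

definition wpartitions :: "nat \<Rightarrow> nat \<Rightarrow> wpartition set" where
  "wpartitions n k =
     {p \<in> {1..k} \<rightarrow>\<^sub>E {P. partition_on {1..n} P}. \<forall>l. 1 \<le> l \<and> l < k \<longrightarrow> refines (p (Suc l)) (p l)}"

definition wp_rank :: "nat \<Rightarrow> wpartition \<Rightarrow> nat" where
  "wp_rank n p = n - card (p 1)"

definition block :: "'a set set \<Rightarrow> 'a \<Rightarrow> 'a set" where
  "block P a = (THE B. B \<in> P \<and> a \<in> B)"

definition merge :: "'a set set \<Rightarrow> 'a \<Rightarrow> 'a \<Rightarrow> 'a set set" where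
  "merge P a b = insert (block P a \<union> block P b) (P - {block P a, block P b})"

definition admissible :: "nat \<Rightarrow> nat \<Rightarrow> wpartition \<Rightarrow> nat \<Rightarrow> nat \<Rightarrow> nat \<Rightarrow> bool" where
  "admissible n k p a b l \<longleftrightarrow>
     1 \<le> a \<and> a < b \<and> b \<le> n \<and> l \<in> {1..k} \<and>
     block (p 1) a \<noteq> block (p 1) b \<and> b = Min (block (p 1) b) \<and> a = Min (block (p l) a)"

definition wp_merge :: "wpartition \<Rightarrow> nat \<Rightarrow> nat \<Rightarrow> nat \<Rightarrow> wpartition" where
  "wp_merge p a b l = (\<lambda>m. if m \<in> {1..l} then merge (p m) a b else p m)"


subsection \<open>The bounded poset\<close>

text \<open>\<open>Some p\<close> is the weighted partition \<open>p\<close>, and \<open>None\<close> is the adjoined greatest element.\<close>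

definition L_carrier :: "nat \<Rightarrow> nat \<Rightarrow> wpartition option set" where
  "L_carrier n k = insert None (Some ` wpartitions n k)"

inductive L_labelled_cover ::
  "nat \<Rightarrow> nat \<Rightarrow> nat \<times> nat \<times> nat \<Rightarrow> wpartition option \<Rightarrow> wpartition option \<Rightarrow> bool"
  for n k where
  merge: "p \<in> wpartitions n k \<Longrightarrow> admissible n k p a b l \<Longrightarrow>
    L_labelled_cover n k (a, b, l) (Some p) (Some (wp_merge p a b l))"
| top: "p \<in> wpartitions n k \<Longrightarrow> wp_rank n p = n - 1 \<Longrightarrow>
    L_labelled_cover n k (1, n, k) (Some p) None"

definition L_cover :: "nat \<Rightarrow> nat \<Rightarrow> wpartition option \<Rightarrow> wpartition option \<Rightarrow> bool" where
  "L_cover n k x y \<longleftrightarrow> (\<exists>lab. L_labelled_cover n k lab x y)"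

definition L_le :: "nat \<Rightarrow> nat \<Rightarrow> wpartition option \<Rightarrow> wpartition option \<Rightarrow> bool" where
  "L_le n k = (L_cover n k)\<^sup>*\<^sup>*"

definition L_bot :: "nat \<Rightarrow> nat \<Rightarrow> wpartition option" where
  "L_bot n k = Some (\<lambda>l\<in>{1..k}. (\<lambda>i. {i}) ` {1..n})"

definition L_top :: "wpartition option" where
  "L_top = None"

definition mu_L :: "nat \<Rightarrow> nat \<Rightarrow> int" where
  "mu_L n k = moebius (L_carrier n k) (L_le n k) (L_bot n k) L_top"


subsection \<open>The Moebius recursion is well-founded here\<close>

definition L_rank :: "nat \<Rightarrow> wpartition option \<Rightarrow> nat" where
  "L_rank n x = (case x of None \<Rightarrow> n | Some p \<Rightarrow> wp_rank n p)"

lemma finite_L_carrier: "finite (L_carrier n k)"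
proof -
  have "finite ({1..k} \<rightarrow>\<^sub>E {P. partition_on {1..n} P})"
    by (intro finite_PiE finitely_many_partition_on) auto
  then show ?thesis
    by (auto simp: L_carrier_def wpartitions_def intro: rev_finite_subset)
qed

lemma block_props:
  assumes "partition_on A P" "a \<in> A"
  shows "block P a \<in> P" "a \<in> block P a"
proof -
  have "\<exists>!B. B \<in> P \<and> a \<in> B"
    using assms by (auto simp: partition_on_def disjoint_def)
  from theI'[OF this] show "block P a \<in> P" "a \<in> block P a"
    by (auto simp: block_def)
qed

lemma card_merge:
  assumes P: "partition_on A P" "finite A" and ab: "a \<in> A" "b \<in> A" "block P a \<noteq> block P b"
  shows "Suc (card (merge P a b)) = card P"
proof -
  have fin: "finite P"
    using P finite_elements by blast
  note B = block_props[OF P(1) ab(1)] block_props[OF P(1) ab(2)]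
  have disj: "B = C" if "B \<in> P" "C \<in> P" "B \<inter> C \<noteq> {}" for B C
    using P(1) that by (auto simp: partition_on_def disjoint_def)
  have new: "block P a \<union> block P b \<notin> P"
    using disj[of "block P a \<union> block P b" "block P a"] disj[of "block P a \<union> block P b" "block P b"]
      B ab(3) by blast
  have "card {block P a, block P b} \<le> card P"
    using B fin by (intro card_mono) auto
  then show ?thesis
    using new fin B ab(3) by (simp add: merge_def card_Diff_subset)
qed

lemma card_partition_le:
  assumes "partition_on {1..n::nat} P"
  shows "card P \<le> n"
proof -
  have B: "Min B \<in> B \<and> B \<subseteq> {1..n}" if "B \<in> P" for B
  proof -
    have sub: "B \<subseteq> {1..n}" and ne: "B \<noteq> {}"
      using assms that by (auto simp: partition_on_def)
    with Min_in[OF finite_subset[OF sub] ne] show ?thesis by simp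
  qed
  have "inj_on Min P"
  proof (rule inj_onI)
    fix C D assume *: "C \<in> P" "D \<in> P" "Min C = Min D"
    then have "Min C \<in> C \<inter> D"
      using B[of C] B[of D] by auto
    then show "C = D"
      using * assms by (auto simp: partition_on_def disjoint_def)
  qed
  moreover have "Min ` P \<subseteq> {1..n}"
    using B by blast
  ultimately have "card P \<le> card {1..n}"
    by (intro card_inj_on_le) auto
  then show ?thesis by simp
qed

lemma L_cover_rank:
  assumes "L_cover n k x y" "n \<ge> 1"
  shows "L_rank n y = Suc (L_rank n x)"
proof -
  obtain lab where "L_labelled_cover n k lab x y"
    using assms by (auto simp: L_cover_def)
  then show ?thesis
  proof cases
    case (merge p a b l)
    have part: "partition_on {1..n} (p 1)" and l: "l \<ge> 1"
      using merge by (auto simp: wpartitions_def admissible_def dest!: PiE_mem[of _ _ _ 1])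
    have "Suc (card (merge (p 1) a b)) = card (p 1)"
      using merge part by (intro card_merge) (auto simp: admissible_def)
    with card_partition_le[OF part] l show ?thesis
      using merge by (simp add: L_rank_def wp_rank_def wp_merge_def)
  next
    case (top p)
    with assms(2) show ?thesis by (simp add: L_rank_def)
  qed
qed

lemma L_le_rank_less:
  assumes "L_le n k x y" "x \<noteq> y" "n \<ge> 1"
  shows "L_rank n x < L_rank n y"
proof -
  have "x = y \<or> L_rank n x < L_rank n y"
    using assms(1) unfolding L_le_def
  proof induction
    case (step y z)
    with L_cover_rank[OF step(2) assms(3)] show ?case by auto
  qed simp
  with assms(2) show ?thesis by simp
qed

lemma L_le_antisym:
  assumes "L_le n k x y" "L_le n k y x" "n \<ge> 1"
  shows "x = y"
  using L_le_rank_less[of n k x y] L_le_rank_less[of n k y x] assms by fastforce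

lemma wf_strict_rel_L:
  assumes "n \<ge> 1"
  shows "wf (strict_rel (L_carrier n k) (L_le n k))"
  by (rule wf_subset[OF wf_measure[of "L_rank n"]])
    (use assms L_le_rank_less in \<open>auto simp: strict_rel_def\<close>)

end

theory Submission
  imports Defs
begin

text \<open>
  Let \<open>T\<^sub>b\<close> be the operator on functions on weighted partitions that sums over all covers with label
  \<open>(a, b)\<^sub>l\<close>. Every merge with \<open>b\<close> removes \<open>b\<close> from the set of block minima of the first layer, so
  \<open>T\<^sub>b\<^sup>2 = 0\<close>, and adjacent merges whose second coordinates descend can be swapped. Hence every interval
  has exactly one chain along which \<open>b\<close> ascends: the zeta operator is \<open>(1 + T\<^sub>1) \<dots> (1 + T\<^sub>n)\<close>, and its
  inverse is \<open>(1 - T\<^sub>n) \<dots> (1 - T\<^sub>1)\<close>. The sum of \<open>\<mu>(0, y)\<close> over all weighted partitions \<open>y\<close> is therefore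
  the value at the least element of the latter applied to the constant \<open>1\<close>. While \<open>b\<close> descends from
  the partition into singletons, every \<open>a < b\<close> and every level \<open>l\<close> are admissible, which gives the
  product of the factors \<open>1 - k (b - 1)\<close>.
\<close>

section \<open>Block minima and merges in a single set partition\<close>

text \<open>The fibres of this function are the blocks, so it determines the partition. In these
  terms admissibility becomes a condition on fixed points, and a merge becomes a pointwise
  update.\<close>

definition bmin :: "nat set set \<Rightarrow> nat \<Rightarrow> nat" where
  "bmin P c = Min (block P c)"

lemma block_eqI:
  assumes "partition_on A P" "B \<in> P" "c \<in> B"
  shows "block P c = B"
proof -
  have "c \<in> A" using assms by (auto simp: partition_on_def)
  with block_props[OF assms(1)] have "block P c \<in> P" "c \<in> block P c" by auto
  with assms show ?thesis by (auto simp: partition_on_def disjoint_def)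
qed

lemma block_subset:
  assumes "partition_on A P" "c \<in> A"
  shows "block P c \<subseteq> A"
  using block_props[OF assms] assms(1) by (auto simp: partition_on_def)

lemma partition_eq_image_block:
  assumes P: "partition_on A P"
  shows "P = block P ` A"
proof
  show "P \<subseteq> block P ` A"
  proof
    fix B assume B: "B \<in> P"
    then obtain c where "c \<in> B" using P unfolding partition_on_def by (metis all_not_in_conv)
    moreover have "c \<in> A" using B \<open>c \<in> B\<close> P by (auto simp: partition_on_def)
    ultimately show "B \<in> block P ` A" using block_eqI[OF P B] by blast
  qed
qed (use block_props[OF P] in blast)

context
  fixes A :: "nat set" and P :: "nat set set"
  assumes P: "partition_on A P" and finA: "finite A"
begin

lemma block_finite_nonempty:
  assumes "c \<in> A"
  shows "finite (block P c)" "block P c \<noteq> {}"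
  using block_props[OF P assms] block_subset[OF P assms] finA by (auto intro: finite_subset)

lemma bmin_in_block: "c \<in> A \<Longrightarrow> bmin P c \<in> block P c"
  unfolding bmin_def using block_finite_nonempty by (intro Min_in)

lemma bmin_in: "c \<in> A \<Longrightarrow> bmin P c \<in> A"
  using bmin_in_block block_subset[OF P] by blast

lemma bmin_le: "c \<in> A \<Longrightarrow> bmin P c \<le> c"
  unfolding bmin_def using block_finite_nonempty block_props[OF P] by (intro Min_le)

lemma in_block_iff:
  assumes "c \<in> A" "d \<in> A"
  shows "d \<in> block P c \<longleftrightarrow> bmin P d = bmin P c"
proof
  assume "d \<in> block P c"
  then have "block P d = block P c"
    using block_eqI[OF P] block_props[OF P assms(1)] by blast
  then show "bmin P d = bmin P c" by (simp add: bmin_def)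
next
  assume eq: "bmin P d = bmin P c"
  have "block P (bmin P e) = block P e" if "e \<in> A" for e
    using block_eqI[OF P] block_props[OF P that] bmin_in_block[OF that] by blast
  with assms eq have "block P d = block P c" by metis
  with block_props[OF P assms(2)] show "d \<in> block P c" by simp
qed

lemma block_eq_Collect: "c \<in> A \<Longrightarrow> block P c = {d \<in> A. bmin P d = bmin P c}"
  using in_block_iff block_subset[OF P] by blast

lemma bmin_bmin: "c \<in> A \<Longrightarrow> bmin P (bmin P c) = bmin P c"
  using in_block_iff bmin_in bmin_in_block by blast

lemma partition_on_merge:
  assumes "a \<in> A" "b \<in> A"
  shows "partition_on A (merge P a b)"
proof (rule partition_onI)
  show "\<Union> (merge P a b) = A"
    using P block_props[OF P assms(1)] block_props[OF P assms(2)]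
    unfolding merge_def partition_on_def by blast
  show "{} \<notin> merge P a b"
    using P block_props[OF P assms(1)] unfolding merge_def partition_on_def by blast
  show "disjnt p q" if "p \<in> merge P a b" "q \<in> merge P a b" "p \<noteq> q" for p q
  proof -
    have D: "B \<inter> C = {}" if "B \<in> P" "C \<in> P" "B \<noteq> C" for B C
      using P that by (auto simp: partition_on_def disjoint_def)
    have "(block P a \<union> block P b) \<inter> C = {}" if "C \<in> P - {block P a, block P b}" for C
      using D[of "block P a" C] D[of "block P b" C] that
        block_props[OF P assms(1)] block_props[OF P assms(2)] by blast
    with D that show ?thesis by (auto simp: merge_def disjnt_def)
  qed
qed

lemma block_merge:
  assumes "a \<in> A" "b \<in> A" "c \<in> A"
  shows "block (merge P a b) c =
    (if c \<in> block P a \<union> block P b then block P a \<union> block P b else block P c)"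
proof (rule block_eqI[OF partition_on_merge[OF assms(1,2)]])
  show "c \<in> (if c \<in> block P a \<union> block P b then block P a \<union> block P b else block P c)"
    using block_props[OF P assms(3)] by auto
  show "(if c \<in> block P a \<union> block P b then block P a \<union> block P b else block P c) \<in> merge P a b"
    using block_props[OF P assms(3)] by (auto simp: merge_def)
qed

text \<open>As \<open>bmin P a <= a < b\<close>, the united block inherits the minimum of the block
  of \<open>a\<close>; only elements with minimum \<open>b\<close> change theirs.\<close>

lemma bmin_merge:
  assumes "a \<in> A" "b \<in> A" "c \<in> A" "bmin P b = b" "a < b"
  shows "bmin (merge P a b) c = (if bmin P c = b then bmin P a else bmin P c)"
proof -
  have ab: "bmin P a < b" using bmin_le[OF assms(1)] assms by simp
  have "Min (block P a \<union> block P b) = min (bmin P a) (bmin P b)"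
    unfolding bmin_def using assms(1,2) block_finite_nonempty by (intro Min_Un)
  with ab assms have "Min (block P a \<union> block P b) = bmin P a" by simp
  then show ?thesis
    using ab assms by (auto simp: bmin_def[of "merge P a b"] block_merge in_block_iff)
      (simp add: bmin_def)
qed

end

lemma partition_eqI_bmin:
  assumes "partition_on A P" "partition_on A Q" "finite A" "\<And>c. c \<in> A \<Longrightarrow> bmin P c = bmin Q c"
  shows "P = Q"
proof -
  have "block P c = block Q c" if "c \<in> A" for c
    using assms that by (auto simp: block_eq_Collect)
  then show ?thesis
    using partition_eq_image_block[OF assms(1)] partition_eq_image_block[OF assms(2)]
    by (metis image_cong)
qed

section \<open>Weighted partitions through the block minima of all layers\<close>

lemma wpartitions_layer:
  assumes "x \<in> wpartitions n k" "m \<in> {1..k}"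
  shows "partition_on {1..n} (x m)"
  using assms by (auto simp: wpartitions_def dest!: PiE_mem)

lemma wpartitions_eqI:
  assumes "x \<in> wpartitions n k" "y \<in> wpartitions n k"
    and "\<And>m c. m \<in> {1..k} \<Longrightarrow> c \<in> {1..n} \<Longrightarrow> bmin (x m) c = bmin (y m) c"
  shows "x = y"
proof (rule PiE_ext)
  show "x \<in> {1..k} \<rightarrow>\<^sub>E {P. partition_on {1..n} P}" "y \<in> {1..k} \<rightarrow>\<^sub>E {P. partition_on {1..n} P}"
    using assms by (auto simp: wpartitions_def)
  show "x m = y m" if "m \<in> {1..k}" for m
    using assms that by (intro partition_eqI_bmin[of "{1..n}"] wpartitions_layer) auto
qed

lemma refines_iff_block:
  assumes "partition_on A P" "partition_on A Q" "finite A"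
  shows "refines P Q \<longleftrightarrow> (\<forall>c\<in>A. block P c \<subseteq> block Q c)"
proof
  assume ref: "refines P Q"
  show "\<forall>c\<in>A. block P c \<subseteq> block Q c"
  proof
    fix c assume c: "c \<in> A"
    then obtain C where C: "C \<in> Q" "block P c \<subseteq> C"
      using ref block_props[OF assms(1)] unfolding refines_def by metis
    with block_eqI[OF assms(2), of C c] block_props[OF assms(1) c] show "block P c \<subseteq> block Q c"
      by blast
  qed
next
  assume sub: "\<forall>c\<in>A. block P c \<subseteq> block Q c"
  show "refines P Q"
    unfolding refines_def
  proof
    fix B assume "B \<in> P"
    then obtain c where "c \<in> A" "B = block P c"
      using partition_eq_image_block[OF assms(1)] by blast
    with sub block_props[OF assms(2)] show "\<exists>C\<in>Q. B \<subseteq> C" by blast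
  qed
qed

lemma wpartitions_block_mono:
  assumes x: "x \<in> wpartitions n k" and m: "1 \<le> m" "m \<le> m'" "m' \<le> k" and c: "c \<in> {1..n}"
  shows "block (x m') c \<subseteq> block (x m) c"
  using m(2,3)
proof (induction m' rule: dec_induct)
  case (step i)
  have "refines (x (Suc i)) (x i)"
    using x step m by (auto simp: wpartitions_def)
  then have "block (x (Suc i)) c \<subseteq> block (x i) c"
    using refines_iff_block[of "{1..n}"] wpartitions_layer[OF x] step m c by auto
  with step show ?case by auto
qed simp

text \<open>The block minimum in layer \<open>m\<close> lies in the larger first-layer block, whose
  minimum is \<open>c\<close>, so it cannot be below \<open>c\<close>.\<close>

lemma wpartitions_bmin_fixed:
  assumes x: "x \<in> wpartitions n k" and m: "m \<in> {1..k}" and c: "c \<in> {1..n}" and "bmin (x 1) c = c"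
  shows "bmin (x m) c = c"
proof -
  have 1: "1 \<in> {1..k}" using m by simp
  note P = wpartitions_layer[OF x m] wpartitions_layer[OF x 1]
  have "bmin (x m) c \<in> block (x 1) c"
    using wpartitions_block_mono[OF x, of 1 m c] m c bmin_in_block[OF P(1) _ c] by auto
  then have "bmin (x 1) (bmin (x m) c) = c"
    using in_block_iff[OF P(2) _ c] bmin_in[OF P(1) _ c] assms(4) by auto
  moreover have "bmin (x 1) (bmin (x m) c) \<le> bmin (x m) c"
    using bmin_in[OF P(1) _ c] by (intro bmin_le[OF P(2)]) auto
  moreover have "bmin (x m) c \<le> c"
    using bmin_le[OF P(1) _ c] by simp
  ultimately show ?thesis by simp
qed

text \<open>A first-layer block containing both \<open>a\<close> and \<open>b\<close> would have its
  minimum \<open>b\<close> above its element \<open>a\<close>.\<close>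

lemma admissible_iff:
  assumes x: "x \<in> wpartitions n k"
  shows "admissible n k x a b l \<longleftrightarrow>
    1 \<le> a \<and> a < b \<and> b \<le> n \<and> l \<in> {1..k} \<and> bmin (x 1) b = b \<and> bmin (x l) a = a"
proof -
  have "block (x 1) a \<noteq> block (x 1) b"
    if "1 \<le> a" "a < b" "b \<le> n" "l \<in> {1..k}" "bmin (x 1) b = b"
  proof
    have "1 \<in> {1..k}" using that by simp
    note P = wpartitions_layer[OF x this]
    assume "block (x 1) a = block (x 1) b"
    then have "bmin (x 1) a = b" using that by (simp add: bmin_def)
    then show False using bmin_le[OF P, of a] that by simp
  qed
  then show ?thesis
    unfolding admissible_def bmin_def by auto
qed

text \<open>Being minimal in the first layer, \<open>b\<close> is minimal in all layers, so
  \<open>bmin_merge\<close> applies in each merged one. Refinement survives at the boundary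
  \<open>m = l\<close>, where only the coarser layer is merged.\<close>

lemma
  assumes x: "x \<in> wpartitions n k" and adm: "admissible n k x a b l"
  shows bmin_wp_merge: "m \<in> {1..k} \<Longrightarrow> c \<in> {1..n} \<Longrightarrow> bmin (wp_merge x a b l m) c =
      (if m \<le> l \<and> bmin (x m) c = b then bmin (x m) a else bmin (x m) c)"
    and wp_merge_in_wpartitions: "wp_merge x a b l \<in> wpartitions n k"
proof -
  note A = adm[unfolded admissible_iff[OF x]]
  have ab: "a \<in> {1..n}" "b \<in> {1..n}" using A by auto
  show "bmin (wp_merge x a b l m) c =
      (if m \<le> l \<and> bmin (x m) c = b then bmin (x m) a else bmin (x m) c)"
    if m: "m \<in> {1..k}" and c: "c \<in> {1..n}"
    using bmin_merge[OF wpartitions_layer[OF x m] _ ab c wpartitions_bmin_fixed[OF x m ab(2)]] A m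
    by (auto simp: wp_merge_def)
  let ?y = "wp_merge x a b l"
  have P: "partition_on {1..n} (?y m)" if "m \<in> {1..k}" for m
    using partition_on_merge[OF wpartitions_layer[OF x that] _ ab] wpartitions_layer[OF x that]
    by (auto simp: wp_merge_def)
  have "refines (?y (Suc m)) (?y m)" if m: "1 \<le> m" "m < k" for m
  proof -
    have "block (?y (Suc m)) c \<subseteq> block (?y m) c" if c: "c \<in> {1..n}" for c
    proof -
      have sub: "block (x (Suc m)) d \<subseteq> block (x m) d" if "d \<in> {1..n}" for d
        using wpartitions_block_mono[OF x _ _ _ that, of m "Suc m"] m by simp
      have Pm: "partition_on {1..n} (x m)" "partition_on {1..n} (x (Suc m))"
        using wpartitions_layer[OF x] m by auto
      note B = block_merge[OF Pm(1) _ ab c] block_merge[OF Pm(2) _ ab c]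
      \<comment> \<open>Needed when \<open>c\<close> joins the united block in layer
        \<open>m\<close> but keeps its block in layer \<open>Suc m\<close>: the latter lies in
        \<open>block (x m) c\<close>, which is the block of \<open>a\<close> or of
        \<open>b\<close>.\<close>
      have "block (x m) c = block (x m) d" if "d \<in> {1..n}" "c \<in> block (x m) d" for d
        using block_eqI[OF Pm(1)] block_props[OF Pm(1) that(1)] that by blast
      then show ?thesis
        using sub[OF ab(1)] sub[OF ab(2)] sub[OF c] ab m by (auto simp: wp_merge_def B)
    qed
    then show ?thesis
      using refines_iff_block[of "{1..n}"] P m by auto
  qed
  moreover have "?y \<in> {1..k} \<rightarrow>\<^sub>E {P. partition_on {1..n} P}"
    using P x A by (auto simp: wpartitions_def PiE_def extensional_def wp_merge_def)
  ultimately show "?y \<in> wpartitions n k"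
    by (simp add: wpartitions_def)
qed

section \<open>Reachability by merges with second coordinate beyond a bound\<close>

definition merge_step :: "nat \<Rightarrow> nat \<Rightarrow> nat \<Rightarrow> wpartition \<Rightarrow> wpartition \<Rightarrow> bool" where
  "merge_step n k b x y \<longleftrightarrow> (\<exists>a c l. b < c \<and> admissible n k x a c l \<and> y = wp_merge x a c l)"

text \<open>Summing a function over this set applies the partial product
  \<open>(1 + T_{b+1}) ... (1 + T_n)\<close> of the zeta operator to it.\<close>

definition reach :: "nat \<Rightarrow> nat \<Rightarrow> nat \<Rightarrow> wpartition \<Rightarrow> wpartition set" where
  "reach n k b x = {y. (merge_step n k b)\<^sup>*\<^sup>* x y}"

lemma reach_refl: "x \<in> reach n k b x"
  by (simp add: reach_def)

lemma reach_trans: "y \<in> reach n k b x \<Longrightarrow> z \<in> reach n k b y \<Longrightarrow> z \<in> reach n k b x"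
  by (auto simp: reach_def)

lemma reach_merge:
  "b < c \<Longrightarrow> admissible n k x a c l \<Longrightarrow> y \<in> reach n k b (wp_merge x a c l) \<Longrightarrow> y \<in> reach n k b x"
  unfolding reach_def mem_Collect_eq
  by (rule converse_rtranclp_into_rtranclp) (auto simp: merge_step_def)

lemma merge_step_mono: "merge_step n k b' x y \<Longrightarrow> b \<le> b' \<Longrightarrow> merge_step n k b x y"
  unfolding merge_step_def using order.strict_trans1 by blast

lemma reach_mono: "b \<le> b' \<Longrightarrow> reach n k b' x \<subseteq> reach n k b x"
  unfolding reach_def
  by (blast intro: rtranclp_mono[THEN predicate2D, rotated] predicate2I dest: merge_step_mono)

text \<open>A merge with \<open>c > b\<close> changes the minima only of elements whose minimum is
  \<open>c\<close>, and these are at least \<open>c\<close>.\<close>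

lemma reach_invariant:
  assumes "y \<in> reach n k b x" "x \<in> wpartitions n k"
  shows "y \<in> wpartitions n k \<and>
    (\<forall>m\<in>{1..k}. \<forall>c\<in>{1..n}. c \<le> b \<longrightarrow> bmin (y m) c = bmin (x m) c)"
  using assms(1) unfolding reach_def mem_Collect_eq
proof induction
  case (step y z)
  then have y: "y \<in> wpartitions n k" by simp
  obtain a c l where z: "b < c" "admissible n k y a c l" "z = wp_merge y a c l"
    using step by (auto simp: merge_step_def)
  have "bmin (z m) d = bmin (y m) d" if "m \<in> {1..k}" "d \<in> {1..n}" "d \<le> b" for m d
    using bmin_wp_merge[OF y z(2) that(1,2)] bmin_le[OF wpartitions_layer[OF y that(1)] _ that(2)] z that
    by auto
  with step wp_merge_in_wpartitions[OF y z(2)] z(3) show ?case by auto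
qed (use assms in auto)

lemmas reach_in_wpartitions = reach_invariant[THEN conjunct1]

lemma finite_wpartitions: "finite (wpartitions n k)"
  using finite_L_carrier[of n k] by (simp add: L_carrier_def finite_image_iff)

lemma finite_reach: "x \<in> wpartitions n k \<Longrightarrow> finite (reach n k b x)"
  using finite_subset[OF _ finite_wpartitions] reach_in_wpartitions by (metis subsetI)

text \<open>
  The first coordinate of the postponed merge can change: if \<open>a = d\<close> and \<open>l \<le> m\<close>, then \<open>a\<close> is no longer
  minimal in its block after the other merge, and the minimum of the new block takes its place.
\<close>

lemma admissible_swap:
  assumes x: "x \<in> wpartitions n k" and adm: "admissible n k x a b l"
    and adm': "admissible n k (wp_merge x a b l) c d m" and "d < b"
  shows "admissible n k x c d m"
    and "\<exists>e. admissible n k (wp_merge x c d m) e b l \<and>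
      wp_merge (wp_merge x a b l) c d m = wp_merge (wp_merge x c d m) e b l"
proof -
  let ?y = "wp_merge x a b l"
  let ?w = "wp_merge x c d m"
  have y: "?y \<in> wpartitions n k" by (rule wp_merge_in_wpartitions[OF x adm])
  note A = adm[unfolded admissible_iff[OF x]]
  note A' = adm'[unfolded admissible_iff[OF y]]
  have le: "bmin (x i) e \<le> e" "bmin (x i) e \<in> {1..n}" "bmin (x i) (bmin (x i) e) = bmin (x i) e"
    if "i \<in> {1..k}" "e \<in> {1..n}" for i e
    using bmin_le[OF wpartitions_layer[OF x that(1)] _ that(2)]
      bmin_in[OF wpartitions_layer[OF x that(1)] _ that(2)]
      bmin_bmin[OF wpartitions_layer[OF x that(1)] _ that(2)] by auto
  have one: "1 \<in> {1..k}" using A by simp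
  \<comment> \<open>Merging with \<open>b\<close> affects only elements from \<open>b\<close> on,
    and \<open>c < d < b\<close>, so the second label can already be tested in
    \<open>x\<close>.\<close>
  have B: "bmin (?y i) e = bmin (x i) e" if "i \<in> {1..k}" "e \<in> {1..n}" "e < b" for i e
    using bmin_wp_merge[OF x adm that(1,2)] le[OF that(1,2)] that by auto
  show adm2: "admissible n k x c d m"
    unfolding admissible_iff[OF x] using A A' B[OF one, of d] B[of m c] assms(4) by auto
  have w: "?w \<in> wpartitions n k" by (rule wp_merge_in_wpartitions[OF x adm2])
  note A2 = adm2[unfolded admissible_iff[OF x]]
  note W = bmin_wp_merge[OF x adm2]
  note Y = bmin_wp_merge[OF x adm]
  define e where "e = bmin (?w l) a"
  have a: "a \<in> {1..n}" "l \<in> {1..k}" "b \<in> {1..n}" "c \<in> {1..n}" "d \<in> {1..n}" "m \<in> {1..k}" using A A2 by auto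
  have e: "e \<in> {1..n}" "e \<le> a" "bmin (?w l) e = e"
    using bmin_le[OF wpartitions_layer[OF w a(2)] _ a(1)]
      bmin_in[OF wpartitions_layer[OF w a(2)] _ a(1)]
      bmin_bmin[OF wpartitions_layer[OF w a(2)] _ a(1)] by (auto simp: e_def)
  have "bmin (?w 1) b = b"
    using W[OF one a(3)] A assms(4) by simp
  then have adm3: "admissible n k ?w e b l"
    unfolding admissible_iff[OF w] using e A by auto
  \<comment> \<open>\<open>e\<close> and \<open>a\<close> share a block in layer \<open>l\<close>,
    hence in every coarser layer, so \<open>e\<close> can stand in for \<open>a\<close> in all
    merged layers.\<close>
  have eb: "bmin (?w i) e = bmin (?w i) a" if i: "i \<in> {1..k}" "i \<le> l" for i
  proof -
    have "e \<in> block (?w l) a"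
      unfolding e_def by (rule bmin_in_block[OF wpartitions_layer[OF w a(2)]]) (use a in auto)
    then have "e \<in> block (?w i) a"
      using wpartitions_block_mono[OF w, of i l a] i a by auto
    then show ?thesis
      using in_block_iff[OF wpartitions_layer[OF w i(1)] _ a(1) e(1)] by simp
  qed
  have "wp_merge ?y c d m = wp_merge ?w e b l"
  proof (rule wpartitions_eqI[OF wp_merge_in_wpartitions[OF y adm'] wp_merge_in_wpartitions[OF w adm3]])
    fix i f assume i: "i \<in> {1..k}" and f: "f \<in> {1..n}"
    have "bmin (x i) b = b" "bmin (x i) d = d"
      using wpartitions_bmin_fixed[OF x i] A A2 a by auto
    moreover have "bmin (x i) a < b" "bmin (x i) c < d"
      using le[OF i a(1)] le[OF i a(4)] A A2 by auto
    ultimately show "bmin (wp_merge ?y c d m i) f = bmin (wp_merge ?w e b l i) f"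
      unfolding bmin_wp_merge[OF y adm' i f] bmin_wp_merge[OF w adm3 i f]
      using eb[OF i] Y[OF i f] W[OF i f] Y[OF i a(4)] W[OF i a(1)] assms(4)
      by auto
  qed
  with adm3 show "\<exists>e. admissible n k ?w e b l \<and> wp_merge ?y c d m = wp_merge ?w e b l" by blast
qed

section \<open>Bringing the merge with the smallest second coordinate to the front\<close>

definition labels :: "nat \<Rightarrow> nat \<Rightarrow> nat \<Rightarrow> wpartition \<Rightarrow> (nat \<times> nat) set" where
  "labels n k b x = {(a, l). admissible n k x a b l}"

lemma finite_labels: "finite (labels n k b x)"
  by (rule finite_subset[of _ "{1..n} \<times> {1..k}"]) (auto simp: labels_def admissible_def)

text \<open>The first-layer block of \<open>b\<close> now has a minimum at most
  \<open>a < b\<close>, so \<open>b\<close> cannot be a second coordinate again: this is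
  \<open>T_b^2 = 0\<close>.\<close>

lemma labels_merge:
  assumes x: "x \<in> wpartitions n k" and adm: "admissible n k x a b l"
  shows "labels n k b (wp_merge x a b l) = {}"
proof -
  note A = adm[unfolded admissible_iff[OF x]]
  have "bmin (x 1) a \<le> a"
    using A by (intro bmin_le[OF wpartitions_layer[OF x]]) auto
  then have "bmin (wp_merge x a b l 1) b \<noteq> b"
    using A bmin_wp_merge[OF x adm, of 1 b] by auto
  then show ?thesis
    using admissible_iff[OF wp_merge_in_wpartitions[OF x adm]] by (auto simp: labels_def)
qed

text \<open>Swapping descents moves a merge with \<open>Suc b\<close> to the start of the chain, and
  \<open>labels_merge\<close> excludes a second one right behind it.\<close>

lemma reach_decomp:
  assumes "x \<in> wpartitions n k"
  shows "reach n k b x = reach n k (Suc b) x \<union>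
    (\<Union>(a, l)\<in>labels n k (Suc b) x. reach n k (Suc b) (wp_merge x a (Suc b) l))" (is "_ = ?R x")
proof
  show "?R x \<subseteq> reach n k b x"
    using reach_mono[of b "Suc b" n k] reach_merge[of b "Suc b" n k x]
    by (fastforce simp: labels_def)
  have "y \<in> ?R x" if "(merge_step n k b)\<^sup>*\<^sup>* x y" for y
    using that assms
  proof (induction rule: converse_rtranclp_induct)
    case (step x x1)
    then obtain a c l where x1: "b < c" "admissible n k x a c l" "x1 = wp_merge x a c l"
      by (auto simp: merge_step_def)
    then have "x1 \<in> wpartitions n k" using wp_merge_in_wpartitions step by blast
    with step have y: "y \<in> ?R x1" by simp
    show ?case
    proof (cases "c = Suc b")
      case True
      then show ?thesis
        using y x1 labels_merge[OF step(4) x1(2)] by (auto simp: labels_def)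
    next
      case False
      with x1(1) have c: "Suc b < c" by simp
      from y consider "y \<in> reach n k (Suc b) x1"
        | a' l' where "admissible n k x1 a' (Suc b) l'" "y \<in> reach n k (Suc b) (wp_merge x1 a' (Suc b) l')"
        by (auto simp: labels_def)
      then show ?thesis
      proof cases
        case 1
        then show ?thesis using reach_merge[OF c x1(2)] x1(3) by blast
      next
        case 2
        note swap = admissible_swap[OF step(4) x1(2) 2(1)[unfolded x1(3)] c]
        obtain e where e: "admissible n k (wp_merge x a' (Suc b) l') e c l"
          "wp_merge x1 a' (Suc b) l' = wp_merge (wp_merge x a' (Suc b) l') e c l"
          using swap(2) x1(3) by auto
        have "y \<in> reach n k (Suc b) (wp_merge x a' (Suc b) l')"
          using reach_merge[OF c e(1)] 2(2) e(2) by simp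
        then show ?thesis using swap(1) by (auto simp: labels_def)
      qed
    qed
  qed (simp add: reach_refl)
  then show "reach n k b x \<subseteq> ?R x" by (auto simp: reach_def)
qed

text \<open>Later merges keep the minimum of \<open>b\<close> in each layer, so \<open>y\<close>
  still shows it: \<open>bmin (x i) a\<close> up to layer \<open>l\<close>, and \<open>b\<close>
  beyond.\<close>

lemma reach_label_inj:
  assumes x: "x \<in> wpartitions n k" and lab: "(a, l) \<in> labels n k b x" "(a', l') \<in> labels n k b x"
    and y: "y \<in> reach n k b (wp_merge x a b l)" "y \<in> reach n k b (wp_merge x a' b l')"
  shows "(a, l) = (a', l')"
proof -
  have adm: "admissible n k x a b l" "admissible n k x a' b l'"
    using lab by (auto simp: labels_def)
  note A = adm[unfolded admissible_iff[OF x]]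
  have b: "b \<in> {1..n}" and m: "m \<in> {1..k} \<Longrightarrow> bmin (x m) b = b" for m
    using A wpartitions_bmin_fixed[OF x, of m b] by auto
  note I = reach_invariant[OF y(1) wp_merge_in_wpartitions[OF x adm(1)]]
    reach_invariant[OF y(2) wp_merge_in_wpartitions[OF x adm(2)]]
  have same: "bmin (wp_merge x a b l i) b = bmin (wp_merge x a' b l' i) b" if "i \<in> {1..k}" for i
    using I b that by auto
  have eq: "(if i \<le> l then bmin (x i) a else b) = (if i \<le> l' then bmin (x i) a' else b)"
    if "i \<in> {1..k}" for i
    using bmin_wp_merge[OF x adm(1) that b] bmin_wp_merge[OF x adm(2) that b] m[OF that] same[OF that]
    by (simp split: if_splits)
  \<comment> \<open>At layer \<open>l\<close> the left side is \<open>a < b\<close>, which forces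
    \<open>l <= l'\<close>; layer \<open>l'\<close> gives the converse, and then
    \<open>a = a'\<close>.\<close>
  show ?thesis
    using eq[of l] eq[of l'] A by (auto split: if_splits)
qed

text \<open>In layer \<open>l\<close> the minimum of \<open>b\<close> is \<open>b\<close> throughout
  the first set and \<open>a\<close> throughout the second.\<close>

lemma reach_merge_disjoint:
  assumes x: "x \<in> wpartitions n k" and lab: "(a, l) \<in> labels n k b x"
  shows "reach n k b x \<inter> reach n k b (wp_merge x a b l) = {}"
proof (rule equals0I)
  fix y assume y: "y \<in> reach n k b x \<inter> reach n k b (wp_merge x a b l)"
  have adm: "admissible n k x a b l"
    using lab by (auto simp: labels_def)
  note A = adm[unfolded admissible_iff[OF x]]
  have b: "b \<in> {1..n}" and l: "l \<in> {1..k}" using A by auto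
  have "bmin (wp_merge x a b l l) b = bmin (x l) b"
    using reach_invariant[of y n k b x] reach_invariant[of y n k b "wp_merge x a b l"]
      wp_merge_in_wpartitions[OF x adm] x y b l by auto
  then show False
    using bmin_wp_merge[OF x adm l b] wpartitions_bmin_fixed[OF x l b] A by simp
qed

section \<open>Inverting the zeta operator\<close>

text \<open>\<open>falling_sum n k b\<close> is \<open>(1 - T\<^sub>b) \<dots> (1 - T\<^sub>1)\<close> applied to the constant \<open>1\<close>.\<close>

fun falling_sum :: "nat \<Rightarrow> nat \<Rightarrow> nat \<Rightarrow> wpartition \<Rightarrow> int" where
  "falling_sum n k 0 x = 1"
| "falling_sum n k (Suc b) x = falling_sum n k b x -
    (\<Sum>(a, l)\<in>labels n k (Suc b) x. falling_sum n k b (wp_merge x a (Suc b) l))"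

text \<open>This splits off the factor \<open>1 + T_{b+1}\<close> of the zeta operator; the pieces
  of \<open>reach_decomp\<close> are disjoint, so nothing is counted twice.\<close>

lemma sum_reach_Suc:
  fixes f :: "wpartition \<Rightarrow> int"
  assumes x: "x \<in> wpartitions n k"
  shows "sum f (reach n k b x) = sum f (reach n k (Suc b) x) +
    (\<Sum>(a, l)\<in>labels n k (Suc b) x. sum f (reach n k (Suc b) (wp_merge x a (Suc b) l)))"
proof -
  let ?M = "\<lambda>(a, l). reach n k (Suc b) (wp_merge x a (Suc b) l)"
  let ?L = "labels n k (Suc b) x"
  have fin: "finite (?M q)" if "q \<in> ?L" for q
    using that wp_merge_in_wpartitions[OF x] finite_reach by (auto simp: labels_def)
  have "sum f (reach n k b x) = sum f (reach n k (Suc b) x) + sum f (\<Union>q\<in>?L. ?M q)"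
    unfolding reach_decomp[OF x, of b]
  proof (rule sum.union_disjoint)
    show "finite (\<Union>q\<in>?L. ?M q)" using fin finite_labels by (rule finite_UN_I[rotated])
    show "reach n k (Suc b) x \<inter> (\<Union>q\<in>?L. ?M q) = {}"
      using reach_merge_disjoint[OF x, of _ _ "Suc b"] by fastforce
  qed (rule finite_reach[OF x])
  also have "sum f (\<Union>q\<in>?L. ?M q) = (\<Sum>q\<in>?L. sum f (?M q))"
  proof (rule sum.UNION_disjoint)
    show "\<forall>q\<in>?L. \<forall>q'\<in>?L. q \<noteq> q' \<longrightarrow> ?M q \<inter> ?M q' = {}"
      using reach_label_inj[OF x, of _ _ "Suc b"] by fast
  qed (use fin finite_labels in auto)
  finally show ?thesis by (simp add: case_prod_unfold)
qed

text \<open>The product \<open>(1 + T_{b+1}) ... (1 + T_n) (1 - T_n) ... (1 - T_1)\<close> collapses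
  from the middle to \<open>(1 - T_b) ... (1 - T_1)\<close>, each cancellation being
  \<open>1 - T_c^2 = 1\<close>.\<close>

lemma sum_reach_falling_sum:
  assumes "b \<le> n" "x \<in> wpartitions n k"
  shows "(\<Sum>y\<in>reach n k b x. falling_sum n k n y) = falling_sum n k b x"
  using assms
proof (induction b arbitrary: x rule: inc_induct)
  case base
  have "y = x" if "y \<in> reach n k n x" for y
    using that unfolding reach_def mem_Collect_eq
    by (rule converse_rtranclpE) (auto simp: merge_step_def admissible_def)
  then have "reach n k n x = {x}" using reach_refl by blast
  then show ?case by simp
next
  case (step b)
  have "falling_sum n k (Suc b) (wp_merge x a (Suc b) l) = falling_sum n k b (wp_merge x a (Suc b) l)"
    if "(a, l) \<in> labels n k (Suc b) x" for a l
    using that labels_merge[OF step.prems] by (simp add: labels_def)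
  then have "(\<Sum>(a, l)\<in>labels n k (Suc b) x. falling_sum n k (Suc b) (wp_merge x a (Suc b) l)) =
      (\<Sum>(a, l)\<in>labels n k (Suc b) x. falling_sum n k b (wp_merge x a (Suc b) l))"
    by (intro sum.cong) auto
  moreover have "(\<Sum>(a, l)\<in>labels n k (Suc b) x.
        sum (falling_sum n k n) (reach n k (Suc b) (wp_merge x a (Suc b) l))) =
      (\<Sum>(a, l)\<in>labels n k (Suc b) x. falling_sum n k (Suc b) (wp_merge x a (Suc b) l))"
    using step.IH wp_merge_in_wpartitions[OF step.prems]
    by (intro sum.cong) (auto simp: labels_def simp del: falling_sum.simps)
  ultimately show ?case
    using sum_reach_Suc[OF step.prems, of "falling_sum n k n" b] step.IH[OF step.prems] by simp
qed

text \<open>Minimality of the elements up to \<open>b\<close> survives a merge with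
  \<open>Suc b\<close>, so the induction passes to the merged partitions. The \<open>b * k\<close>
  merges share one value, which gives the factor \<open>1 - k * b\<close>.\<close>

lemma falling_sum_eq_prod:
  assumes "x \<in> wpartitions n k" "b \<le> n" "\<And>c. c \<in> {1..b} \<Longrightarrow> bmin (x 1) c = c"
  shows "falling_sum n k b x = (\<Prod>i<b. 1 - int k * int i)"
  using assms
proof (induction b arbitrary: x)
  case (Suc b)
  note x = Suc.prems(1)
  have fixed: "bmin (x m) c = c" if "m \<in> {1..k}" "c \<in> {1..Suc b}" for m c
    using wpartitions_bmin_fixed[OF x that(1)] Suc.prems that by auto
  have labels: "labels n k (Suc b) x = {1..b} \<times> {1..k}"
    using fixed Suc.prems by (auto simp: labels_def admissible_iff[OF x])
  have "falling_sum n k b (wp_merge x a (Suc b) l) = (\<Prod>i<b. 1 - int k * int i)"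
    if "(a, l) \<in> {1..b} \<times> {1..k}" for a l
  proof -
    have adm: "admissible n k x a (Suc b) l" using that labels by (auto simp: labels_def)
    show ?thesis
    proof (rule Suc.IH[OF wp_merge_in_wpartitions[OF x adm]])
      fix c assume "c \<in> {1..b}"
      then show "bmin (wp_merge x a (Suc b) l 1) c = c"
        using bmin_wp_merge[OF x adm, of 1 c] Suc.prems that by auto
    qed (use Suc.prems in simp)
  qed
  then have "(\<Sum>(a, l)\<in>labels n k (Suc b) x. falling_sum n k b (wp_merge x a (Suc b) l)) =
      (\<Sum>_\<in>{1..b} \<times> {1..k}. \<Prod>i<b. 1 - int k * int i)"
    unfolding labels by (intro sum.cong) auto
  moreover have "falling_sum n k b x = (\<Prod>i<b. 1 - int k * int i)"
    using Suc by simp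
  ultimately show ?case by (simp add: algebra_simps)
qed simp

section \<open>The order of the bounded poset and its Moebius function\<close>

lemma L_le_Some_iff:
  assumes x: "x \<in> wpartitions n k"
  shows "L_le n k (Some x) (Some y) \<longleftrightarrow> y \<in> reach n k 0 x"
proof
  \<comment> \<open>The induction runs over all endpoints, so the top receives the claim
    \<open>True\<close>; no cover starts there.\<close>
  have "case z of None \<Rightarrow> True | Some y \<Rightarrow> y \<in> reach n k 0 x" if "L_le n k (Some x) z" for z
    using that unfolding L_le_def
  proof induction
    case (step z w)
    from step(2) obtain lab where "L_labelled_cover n k lab z w" by (auto simp: L_cover_def)
    then show ?case
    proof cases
      case (merge p a b l)
      then have "merge_step n k 0 p (wp_merge p a b l)"
        unfolding merge_step_def by (intro exI[of _ a] exI[of _ b] exI[of _ l]) (simp add: admissible_def)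
      with merge step show ?thesis by (auto simp: reach_def)
    qed simp
  qed (simp add: reach_refl)
  then show "L_le n k (Some x) (Some y) \<Longrightarrow> y \<in> reach n k 0 x" by fastforce
next
  assume "y \<in> reach n k 0 x"
  then have "(merge_step n k 0)\<^sup>*\<^sup>* x y" by (simp add: reach_def)
  then show "L_le n k (Some x) (Some y)"
    unfolding L_le_def
  proof induction
    case (step y z)
    then have "y \<in> wpartitions n k"
      using reach_in_wpartitions[OF _ x, of y 0] by (simp add: reach_def)
    with step have "L_cover n k (Some y) (Some z)"
      by (auto simp: L_cover_def merge_step_def intro: L_labelled_cover.merge)
    with step show ?case by simp
  qed simp
qed

text \<open>While the first layer has several blocks, \<open>1\<close> can be merged at level
  \<open>1\<close> with a block minimum \<open>d\<close> other than \<open>1\<close>; the rank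
  climbs until a single block is left, which the top covers.\<close>

lemma L_le_None:
  assumes "x \<in> wpartitions n k" "n \<ge> 1" "k \<ge> 1"
  shows "L_le n k (Some x) None"
  using assms(1)
proof (induction "n - wp_rank n x" arbitrary: x rule: less_induct)
  case less
  have one: "1 \<in> {1..k}" using assms by simp
  note P = wpartitions_layer[OF less.prems one]
  \<comment> \<open>A nonempty first layer keeps the rank below \<open>n\<close>, so the truncated
    difference used as induction measure really decreases.\<close>
  have "x 1 \<noteq> {}" using P assms(2) by (auto simp: partition_on_def)
  moreover have "finite (x 1)" using finite_elements[OF _ P] by simp
  ultimately have card: "card (x 1) > 0" by (simp add: card_gt_0_iff)
  show ?case
  proof (cases "card (x 1) = 1")
    case True
    then have "L_cover n k (Some x) None"
      using less.prems by (auto simp: L_cover_def wp_rank_def intro!: exI L_labelled_cover.top)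
    then show ?thesis by (simp add: L_le_def)
  next
    case False
    have "\<exists>c\<in>{1..n}. bmin (x 1) c \<noteq> 1"
    proof (rule ccontr)
      assume "\<not> ?thesis"
      then have "block (x 1) c = {1..n}" if "c \<in> {1..n}" for c
        using block_eq_Collect[OF P _ that] that by auto
      then have "block (x 1) ` {1..n} = {{1..n}}" using assms(2) by auto
      with partition_eq_image_block[OF P] have "x 1 = {{1..n}}" by metis
      with False show False by simp
    qed
    then obtain c where c: "c \<in> {1..n}" "bmin (x 1) c \<noteq> 1" by blast
    define d where "d = bmin (x 1) c"
    have d: "d \<in> {1..n}" "bmin (x 1) d = d" "d \<noteq> 1"
      using c bmin_in[OF P _ c(1)] bmin_bmin[OF P _ c(1)] by (auto simp: d_def)
    have "bmin (x 1) 1 = 1"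
      using bmin_le[OF P, of 1] bmin_in[OF P, of 1] assms(2) by simp
    then have adm: "admissible n k x 1 d 1"
      unfolding admissible_iff[OF less.prems] using d assms by auto
    let ?y = "wp_merge x 1 d 1"
    have cover: "L_cover n k (Some x) (Some ?y)"
      using less.prems adm by (auto simp: L_cover_def intro: L_labelled_cover.merge)
    have "wp_rank n ?y = Suc (wp_rank n x)"
      using L_cover_rank[OF cover assms(2)] by (simp add: L_rank_def)
    moreover have "wp_rank n x < n" using card assms(2) by (simp add: wp_rank_def)
    ultimately have "L_le n k (Some ?y) None"
      using less.hyps[of ?y] wp_merge_in_wpartitions[OF less.prems adm] by simp
    with cover show ?thesis
      unfolding L_le_def by (rule converse_rtranclp_into_rtranclp)
  qed
qed

definition singletons :: "nat \<Rightarrow> nat \<Rightarrow> wpartition" where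
  "singletons n k = (\<lambda>l\<in>{1..k}. (\<lambda>i. {i}) ` {1..n})"

lemma partition_on_singletons: "partition_on A ((\<lambda>i. {i}) ` A)"
  by (auto simp: partition_on_def disjoint_def)

lemma singletons_in_wpartitions: "singletons n k \<in> wpartitions n k"
  using partition_on_singletons[of "{1..n}"]
  by (auto simp: wpartitions_def singletons_def refines_def)

lemma bmin_singletons: "m \<in> {1..k} \<Longrightarrow> c \<in> {1..n} \<Longrightarrow> bmin (singletons n k m) c = c"
  using block_eqI[OF partition_on_singletons, of "{c}" "{1..n}" c] by (simp add: bmin_def singletons_def)

text \<open>Moebius inversion: \<open>mu_L n k\<close> is minus the sum of \<open>g\<close>. Writing
  the weight \<open>1\<close> at \<open>z\<close> as the sum of \<open>falling_sum n k n\<close>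
  over all \<open>y\<close> above \<open>z\<close> and exchanging the sums leaves only the term at
  \<open>x0\<close>.\<close>

lemma mu_L_eq_falling_sum:
  assumes n: "n \<ge> 1" and k: "k \<ge> 1"
  shows "mu_L n k = - falling_sum n k n (singletons n k)"
proof -
  define x0 where "x0 = singletons n k"
  define g where "g = (\<lambda>z. moebius (L_carrier n k) (L_le n k) (Some x0) (Some z))"
  have x0: "x0 \<in> wpartitions n k" and bot: "L_bot n k = Some x0"
    using singletons_in_wpartitions by (auto simp: x0_def L_bot_def singletons_def)
  note rec = moebius_rec[OF wf_strict_rel_L[OF n, of k]]
  let ?Q = "reach n k 0 x0"
  have Q: "?Q \<subseteq> wpartitions n k" using reach_in_wpartitions[OF _ x0] by blast
  have fin: "finite ?Q" by (rule finite_reach[OF x0])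
  \<comment> \<open>The defining recursion with the term at \<open>y\<close> brought to the other
    side.\<close>
  have g_sum: "(\<Sum>z | z \<in> ?Q \<and> y \<in> reach n k 0 z. g z) = (if y = x0 then 1 else 0)" if y: "y \<in> ?Q" for y
  proof (cases "y = x0")
    case True
    have "{z \<in> ?Q. x0 \<in> reach n k 0 z} = {x0}"
      using L_le_antisym[OF _ _ n, of k "Some x0"] L_le_Some_iff[OF x0] L_le_Some_iff Q reach_refl
      by blast
    moreover have "g x0 = 1" using rec[of "Some x0" "Some x0"] x0 by (simp add: g_def L_carrier_def)
    ultimately show ?thesis using True by simp
  next
    case False
    let ?S = "{z \<in> ?Q. y \<in> reach n k 0 z \<and> z \<noteq> y}"
    have "{z. z \<in> L_carrier n k \<and> L_le n k (Some x0) z \<and> L_le n k z (Some y) \<and> z \<noteq> Some y} = Some ` ?S"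
    proof -
      have "\<not> L_le n k None (Some y)"
        using L_le_rank_less[OF _ _ n, of k None "Some y"] by (auto simp: L_rank_def wp_rank_def)
      then show ?thesis
        using Q by (auto simp: L_carrier_def L_le_Some_iff x0)
    qed
    then have "g y = - (\<Sum>z\<in>?S. g z)"
      using rec[of "Some y" "Some x0"] False y Q by (auto simp: g_def L_carrier_def sum.reindex)
    moreover have "{z \<in> ?Q. y \<in> reach n k 0 z} = insert y ?S"
      using y reach_refl by auto
    ultimately show ?thesis using False fin by simp
  qed
  have "{z. z \<in> L_carrier n k \<and> L_le n k (Some x0) z \<and> L_le n k z None \<and> z \<noteq> None} = Some ` ?Q"
    using Q L_le_None[OF _ n k] by (auto simp: L_carrier_def L_le_Some_iff x0)
  then have "mu_L n k = - (\<Sum>z\<in>?Q. g z)"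
    unfolding mu_L_def bot L_top_def
    by (subst rec) (auto simp: g_def L_carrier_def sum.reindex)
  also have "(\<Sum>z\<in>?Q. g z) = (\<Sum>z\<in>?Q. \<Sum>y | y \<in> ?Q \<and> y \<in> reach n k 0 z. g z * falling_sum n k n y)"
  proof (rule sum.cong)
    fix z assume z: "z \<in> ?Q"
    have "{y. y \<in> ?Q \<and> y \<in> reach n k 0 z} = reach n k 0 z"
      using reach_trans[OF z] by blast
    then show "g z = (\<Sum>y | y \<in> ?Q \<and> y \<in> reach n k 0 z. g z * falling_sum n k n y)"
      using sum_reach_falling_sum[of 0 n z k] z Q by (auto simp flip: sum_distrib_left)
  qed simp
  also have "\<dots> = (\<Sum>y\<in>?Q. \<Sum>z | z \<in> ?Q \<and> y \<in> reach n k 0 z. g z * falling_sum n k n y)"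
    by (rule sum.swap_restrict[OF fin fin])
  also have "\<dots> = (\<Sum>y\<in>?Q. if y = x0 then falling_sum n k n y else 0)"
    using g_sum by (intro sum.cong) (auto simp flip: sum_distrib_right)
  also have "\<dots> = falling_sum n k n x0"
    using fin reach_refl[of x0] by simp
  finally show ?thesis by (simp add: x0_def)
qed

section \<open>The product formula and the binomial series\<close>

lemma mu_L_eq_prod:
  assumes "k \<ge> 1"
  shows "mu_L (Suc n) k = - (\<Prod>i<n. 1 - int k * int (Suc i))"
proof -
  have "mu_L (Suc n) k = - (\<Prod>i<Suc n. 1 - int k * int i)"
    using mu_L_eq_falling_sum[of "Suc n" k] assms
      falling_sum_eq_prod[OF singletons_in_wpartitions, of "Suc n" "Suc n" k] bmin_singletons[of 1 k _ "Suc n"]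
    by simp
  \<comment> \<open>The factor at \<open>i = 0\<close> is \<open>1\<close>; splitting it off shifts
    the index.\<close>
  then show ?thesis by (simp add: prod.lessThan_Suc_shift del: prod.lessThan_Suc)
qed

theorem mainTheorem1:
  fixes k :: nat
  assumes "k \<ge> 1"
  shows "Abs_fps (\<lambda>n. (- 1) ^ (n + 1) * of_int (mu_L (n + 1) k) / fact n) =
    fps_binomial (- ((of_nat k - 1) / of_nat k)) oo (- (fps_const (of_nat k) * fps_X) :: rat fps)"
proof (rule fps_ext)
  fix n
  let ?a = "- ((of_nat k - 1) / of_nat k) :: rat"
  have lin: "- (fps_const (of_nat k) * fps_X) = fps_const (- of_nat k :: rat) * fps_X"
    by (simp flip: fps_const_neg)
  have "(- 1) ^ (n + 1) * of_int (mu_L (n + 1) k) = (- 1) ^ n * (\<Prod>i<n. 1 - of_nat k * of_nat (Suc i) :: rat)"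
    using mu_L_eq_prod[OF assms, of n] by simp
  also have "\<dots> = (\<Prod>i<n. (- 1) * (1 - of_nat k * of_nat (Suc i)))"
    unfolding prod.distrib by simp
  \<comment> \<open>Both factors equal \<open>k * i + k - 1\<close>; since \<open>k\<close> is
    nonzero, it cancels against the denominator of \<open>?a\<close>.\<close>
  also have "\<dots> = (\<Prod>i<n. - of_nat k * (?a - of_nat i))"
    using assms by (intro prod.cong) (auto simp: field_simps)
  also have "\<dots> = (- of_nat k) ^ n * (\<Prod>i<n. ?a - of_nat i)"
    unfolding prod.distrib by simp
  finally have eq: "(- 1) ^ (n + 1) * of_int (mu_L (n + 1) k) = (- of_nat k) ^ n * (\<Prod>i<n. ?a - of_nat i)" .
  \<comment> \<open>Substituting \<open>- k X\<close> scales the coefficient by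
    \<open>(- k)^n\<close>; that of the binomial series is the falling product of \<open>?a\<close>
    divided by \<open>n!\<close>.\<close>
  show "fps_nth (Abs_fps (\<lambda>n. (- 1) ^ (n + 1) * of_int (mu_L (n + 1) k) / fact n)) n =
      fps_nth (fps_binomial ?a oo - (fps_const (of_nat k) * fps_X)) n"
    unfolding lin fps_compose_linear fps_nth_Abs_fps eq
    by (simp add: gbinomial_prod_rev atLeast0LessThan)
qed

end
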